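(* Suppose $X$ is a strongly pseudoradial space which has unique strong pseudoradial convergence. Suppose $\alpha$ is a noncompact well-ordered space and $h:\alpha\cup\{\infty_\alpha\}\to X$ is a continuous injection. Then $h(\alpha\cup\{\infty_\alpha\})$ is closed in $X$.
   Context: A well-ordered space is a well-ordered set with the order topology. If $\alpha$ is a noncompact well-ordered space, $\alpha\cup\{\infty_\alpha\}$ denotes its one-point compactification, obtained by adding a maximal point $\infty_\alpha$ whose basic neighborhoods are $(a,\infty_\alpha]$, $a\in\alpha$. A map is a continuous function. A space $X$ is strongly pseudoradial if for each nonclosed $A\subset X$ there exist a noncompact well-ordered space $\alpha$ and a map $f:\alpha\cup\{\infty_\alpha\}\to X$ with $f(\alpha)\subset A$ and $f(\infty_\alpha)\notin A$. A space $X$ has unique strong pseudoradial convergence if $f(\infty_\alpha)=g(\infty_\alpha)$ for all noncompact well-ordered spaces $\alpha$ and all pairs of maps $f,g:\alpha\cup\{\infty_\alpha\}\to X$ such that $f|\alpha=g|\alpha$. *)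

theory Defs
  imports "HOL-Analysis.Analysis"
begin

text \<open>
  A well-ordered space is given by a well-order relation \<open>r\<close> with carrier \<open>Field r\<close>, as in
  the HOL library of well-orders (where \<open>underS r a\<close> and \<open>aboveS r a\<close> are the open initial and
  final segments at \<open>a\<close>). Listing \<open>Field r\<close> in the subbase matters only when \<open>r\<close> has at most
  one point.
\<close>

definition order_top :: "'w rel \<Rightarrow> 'w topology" where
  "order_top r =
     topology_generated_by ({Field r} \<union> underS r ` Field r \<union> aboveS r ` Field r)"

definition noncompact_wo_space :: "'w rel \<Rightarrow> bool" where
  "noncompact_wo_space r \<longleftrightarrow> Well_order r \<and> \<not> compact_space (order_top r)"

text \<open>
  The added point is \<open>None\<close>. Lemma \<open>openin_wo_compactification\<close> below shows that
  its basic neighbourhoods are the sets \<open>(a, None]\<close>.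
\<close>

abbreviation wo_compactification :: "'w rel \<Rightarrow> 'w option topology" where
  "wo_compactification r \<equiv> Alexandroff_compactification (order_top r)"

text \<open>
  The quantifiers over all well-ordered spaces range over a proper class, and HOL cannot quantify
  over types inside a definition. So both notions are first defined relative to the
  well-ordered spaces carried by subsets of a type \<open>'w\<close>, and then at one type depending only on
  the type of the points of the space. Lemmas \<open>strongly_pseudoradial_witness_transfer\<close>,
  \<open>strongly_pseudoradial_if\<close> and \<open>unique_strong_pseudoradial_convergence_imp\<close> show that this loses nothing: a witness of
  strong pseudoradiality on any type whatsoever can be replaced by one on the chosen type, and
  uniqueness on the chosen type implies uniqueness on every type.
\<close>

definition strongly_pseudoradial_on :: "'w itself \<Rightarrow> 'a topology \<Rightarrow> bool" where
  "strongly_pseudoradial_on (_ :: 'w itself) X \<longleftrightarrow>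
     (\<forall>A. A \<subseteq> topspace X \<and> \<not> closedin X A \<longrightarrow>
       (\<exists>(r :: 'w rel) f. noncompact_wo_space r \<and>
          continuous_map (wo_compactification r) X f \<and>
          f ` Some ` Field r \<subseteq> A \<and> f None \<notin> A))"

definition unique_strong_pseudoradial_convergence_on :: "'w itself \<Rightarrow> 'a topology \<Rightarrow> bool" where
  "unique_strong_pseudoradial_convergence_on (_ :: 'w itself) X \<longleftrightarrow>
     (\<forall>(r :: 'w rel) f g. noncompact_wo_space r \<and>
          continuous_map (wo_compactification r) X f \<and>
          continuous_map (wo_compactification r) X g \<and>
          (\<forall>a\<in>Field r. f (Some a) = g (Some a)) \<longrightarrow>
        f None = g None)"

definition strongly_pseudoradial :: "'a topology \<Rightarrow> bool" where
  "strongly_pseudoradial X \<longleftrightarrow> strongly_pseudoradial_on TYPE('a set + nat) X"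

definition unique_strong_pseudoradial_convergence :: "'a topology \<Rightarrow> bool" where
  "unique_strong_pseudoradial_convergence X \<longleftrightarrow>
     unique_strong_pseudoradial_convergence_on TYPE('a set + nat) X"


subsection \<open>The order topology of a well-order and its compactification\<close>

lemma topspace_order_top [simp]: "topspace (order_top r) = Field r"
  by (auto simp: order_top_def underS_def aboveS_def Field_def)

lemma wo_refl: "Well_order r \<Longrightarrow> a \<in> Field r \<Longrightarrow> (a, a) \<in> r"
  by (auto simp: order_on_defs refl_on_def)

lemma wo_trans: "Well_order r \<Longrightarrow> (a, b) \<in> r \<Longrightarrow> (b, c) \<in> r \<Longrightarrow> (a, c) \<in> r"
  by (meson order_on_defs transD)

lemma wo_antisym: "Well_order r \<Longrightarrow> (a, b) \<in> r \<Longrightarrow> (b, a) \<in> r \<Longrightarrow> a = b"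
  by (meson order_on_defs antisymD)

lemma wo_total: "Well_order r \<Longrightarrow> a \<in> Field r \<Longrightarrow> b \<in> Field r \<Longrightarrow> (a, b) \<in> r \<or> (b, a) \<in> r"
  by (metis wo_rel.TOTALS wo_rel_def)

lemma wo_least:
  assumes "Well_order r" "S \<subseteq> Field r" "S \<noteq> {}"
  obtains m where "m \<in> S" "\<And>s. s \<in> S \<Longrightarrow> (m, s) \<in> r"
proof -
  interpret wo_rel r using assms(1) by (simp add: wo_rel_def)
  show ?thesis
    using that[of "minim S"] minim_in[of S] minim_least[of S] assms(2,3) by blast
qed

lemma wo_induct:
  assumes "Well_order r" "a \<in> Field r"
    and "\<And>a. a \<in> Field r \<Longrightarrow> (\<And>b. b \<in> underS r a \<Longrightarrow> P b) \<Longrightarrow> P a"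
  shows "P a"
proof (rule ccontr)
  assume "\<not> P a"
  then obtain m where m: "m \<in> {x\<in>Field r. \<not> P x}" "\<And>s. s \<in> {x\<in>Field r. \<not> P x} \<Longrightarrow> (m, s) \<in> r"
    using wo_least[OF assms(1), of "{x\<in>Field r. \<not> P x}"] assms(2) by blast
  have "P b" if "b \<in> underS r m" for b
    using that m(2)[of b] wo_antisym[OF assms(1), of b m]
    by (auto simp: underS_def Field_def)
  then show False using assms(3) m(1) by blast
qed

definition wo_nbhd :: "'w rel \<Rightarrow> 'w \<Rightarrow> 'w set \<Rightarrow> bool" where
  "wo_nbhd r x U \<longleftrightarrow>
     (underS r x = {} \<and> x \<in> U) \<or> (\<exists>a\<in>underS r x. aboveS r a \<inter> under r x \<subseteq> U)"

lemma wo_nbhd_mono: "wo_nbhd r x U \<Longrightarrow> U \<subseteq> V \<Longrightarrow> wo_nbhd r x V"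
  unfolding wo_nbhd_def by blast

lemma wo_nbhd_Int:
  assumes "Well_order r" "wo_nbhd r x U" "wo_nbhd r x V"
  shows "wo_nbhd r x (U \<inter> V)"
proof (cases "underS r x = {}")
  case True
  then show ?thesis using assms by (auto simp: wo_nbhd_def)
next
  case False
  then obtain a b where a: "a \<in> underS r x" "aboveS r a \<inter> under r x \<subseteq> U"
    and b: "b \<in> underS r x" "aboveS r b \<inter> under r x \<subseteq> V"
    using assms by (auto simp: wo_nbhd_def)
  have "a \<in> Field r" "b \<in> Field r"
    using a b by (auto simp: underS_def Field_def)
  then consider "(a, b) \<in> r" | "(b, a) \<in> r" using wo_total[OF assms(1)] by blast
  then show ?thesis
  proof cases
    case 1
    then have "aboveS r b \<subseteq> aboveS r a"
      using wo_trans[OF assms(1)] wo_antisym[OF assms(1)] by (auto simp: aboveS_def)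
    then show ?thesis unfolding wo_nbhd_def using a b by blast
  next
    case 2
    then have "aboveS r a \<subseteq> aboveS r b"
      using wo_trans[OF assms(1)] wo_antisym[OF assms(1)] by (auto simp: aboveS_def)
    then show ?thesis unfolding wo_nbhd_def using a b by blast
  qed
qed

lemma under_eq_Field_if:
  assumes "Well_order r" "x \<in> Field r" "aboveS r x = {}"
  shows "under r x = Field r"
proof
  show "under r x \<subseteq> Field r" by (auto simp: under_def Field_def)
  show "Field r \<subseteq> under r x"
  proof
    fix y assume "y \<in> Field r"
    then have "(x, y) \<in> r \<or> (y, x) \<in> r" using wo_total[OF assms(1,2)] by blast
    then show "y \<in> under r x"
      using assms(3) wo_refl[OF assms(1,2)] by (auto simp: under_def aboveS_def)
  qed
qed

lemma openin_under:
  assumes "Well_order r" "x \<in> Field r"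
  shows "openin (order_top r) (under r x)"
proof (cases "aboveS r x = {}")
  case True
  have "under r x = Field r"
    using True by (rule under_eq_Field_if[OF assms])
  then show ?thesis
    by (simp add: order_top_def topology_generated_by_Basis)
next
  case False
  have "aboveS r x \<subseteq> Field r" by (auto simp: aboveS_def Field_def)
  then obtain m where m: "m \<in> aboveS r x" "\<And>s. s \<in> aboveS r x \<Longrightarrow> (m, s) \<in> r"
    using wo_least[OF assms(1) _ False] by blast
  have mF: "m \<in> Field r" using m by (auto simp: aboveS_def Field_def)
  have "under r x = underS r m"
  proof (intro equalityI subsetI)
    fix y assume "y \<in> under r x"
    then show "y \<in> underS r m"
      using m(1) wo_trans[OF assms(1), of y x m] wo_antisym[OF assms(1), of x m]
      by (auto simp: under_def underS_def aboveS_def)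
  next
    fix y assume y: "y \<in> underS r m"
    then have "y \<in> Field r" by (auto simp: underS_def Field_def)
    then have "(y, x) \<in> r \<or> (x, y) \<in> r" using wo_total[OF assms(1)] assms(2) by blast
    then show "y \<in> under r x"
      using y m(2)[of y] wo_antisym[OF assms(1), of y m] wo_refl[OF assms]
      by (auto simp: under_def underS_def aboveS_def)
  qed
  then show ?thesis using mF
    by (simp add: order_top_def topology_generated_by_Basis)
qed

lemma openin_order_top_iff:
  assumes wo: "Well_order r"
  shows "openin (order_top r) U \<longleftrightarrow> U \<subseteq> Field r \<and> (\<forall>x\<in>U. wo_nbhd r x U)"
proof
  assume U: "openin (order_top r) U"
  then have "U \<subseteq> Field r" using openin_subset by fastforce
  moreover have "\<forall>x\<in>U. wo_nbhd r x U"
    using openin_topology_generated_by[OF U[unfolded order_top_def]]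
  proof induction
    case Empty
    then show ?case by simp
  next
    case (Int a b)
    then show ?case using wo_nbhd_Int[OF wo] by blast
  next
    case (UN K)
    then show ?case by (meson Union_iff Union_upper wo_nbhd_mono)
  next
    case (Basis s)
    show ?case
    proof
      fix x assume x: "x \<in> s"
      have xF: "x \<in> Field r"
        using x Basis by (auto simp: underS_def aboveS_def Field_def)
      have down: "wo_nbhd r x s" if "under r x \<subseteq> s"
        using that x by (auto simp: wo_nbhd_def)
      consider "s = Field r" | c where "c \<in> Field r" "s = underS r c"
        | c where "c \<in> Field r" "s = aboveS r c" using Basis by blast
      then show "wo_nbhd r x s"
      proof cases
        case 1
        then show ?thesis using down by (auto simp: under_def Field_def)
      next
        case 2
        have "under r x \<subseteq> s"
          using x 2 wo_trans[OF wo] wo_antisym[OF wo] by (auto simp: under_def underS_def)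
        then show ?thesis by (rule down)
      next
        case 3
        then have "c \<in> underS r x" using x by (auto simp: underS_def aboveS_def)
        then show ?thesis unfolding wo_nbhd_def using 3 by blast
      qed
    qed
  qed
  ultimately show "U \<subseteq> Field r \<and> (\<forall>x\<in>U. wo_nbhd r x U)" by blast
next
  assume R: "U \<subseteq> Field r \<and> (\<forall>x\<in>U. wo_nbhd r x U)"
  show "openin (order_top r) U"
  proof (subst openin_subopen, intro ballI)
    fix x assume x: "x \<in> U"
    then have xF: "x \<in> Field r" using R by blast
    note op = openin_under[OF wo xF]
    have xx: "x \<in> under r x" using wo_refl[OF wo xF] by (simp add: under_def)
    have "wo_nbhd r x U" using R x by blast
    then consider "underS r x = {}" | a where "a \<in> underS r x" "aboveS r a \<inter> under r x \<subseteq> U"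
      by (auto simp: wo_nbhd_def)
    then show "\<exists>T. openin (order_top r) T \<and> x \<in> T \<and> T \<subseteq> U"
    proof cases
      case 1
      then have "under r x \<subseteq> U" using x by (auto simp: under_def underS_def)
      then show ?thesis using op xx by blast
    next
      case 2
      then have "a \<in> Field r" "x \<in> aboveS r a" by (auto simp: underS_def aboveS_def Field_def)
      moreover from this have "openin (order_top r) (aboveS r a)"
        by (simp add: order_top_def topology_generated_by_Basis)
      ultimately show ?thesis using op xx 2 by (meson IntI openin_Int)
    qed
  qed
qed

lemma compactin_under:
  assumes wo: "Well_order r" and "a \<in> Field r"
  shows "compactin (order_top r) (under r a)"
  using assms(2)
proof (rule wo_induct[OF wo])
  fix a assume a: "a \<in> Field r"
    and IH: "\<And>b. b \<in> underS r a \<Longrightarrow> compactin (order_top r) (under r b)"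
  show "compactin (order_top r) (under r a)"
    unfolding compactin_def
  proof (intro conjI allI impI)
    show "under r a \<subseteq> topspace (order_top r)" by (auto simp: under_def Field_def)
    fix \<U> assume \<U>: "Ball \<U> (openin (order_top r)) \<and> under r a \<subseteq> \<Union>\<U>"
    have "a \<in> under r a" using wo_refl[OF wo a] by (simp add: under_def)
    then obtain V where V: "V \<in> \<U>" "a \<in> V" using \<U> by blast
    then have "wo_nbhd r a V" using \<U> openin_order_top_iff[OF wo] by blast
    then consider "underS r a = {}" | b where "b \<in> underS r a" "aboveS r b \<inter> under r a \<subseteq> V"
      by (auto simp: wo_nbhd_def)
    then show "\<exists>\<F>. finite \<F> \<and> \<F> \<subseteq> \<U> \<and> under r a \<subseteq> \<Union>\<F>"
    proof cases
      case 1
      then have "under r a \<subseteq> \<Union>{V}" using V by (auto simp: under_def underS_def)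
      then show ?thesis using V by (intro exI[of _ "{V}"]) auto
    next
      case 2
      have "under r b \<subseteq> under r a"
        using 2 wo_trans[OF wo] by (auto simp: under_def underS_def)
      then have "under r b \<subseteq> \<Union>\<U>" using \<U> by blast
      then obtain \<F> where \<F>: "finite \<F>" "\<F> \<subseteq> \<U>" "under r b \<subseteq> \<Union>\<F>"
        using IH[OF 2(1)] \<U> unfolding compactin_def by meson
      have bF: "b \<in> Field r" using 2 by (auto simp: underS_def Field_def)
      have "under r a \<subseteq> under r b \<union> V"
      proof
        fix y assume y: "y \<in> under r a"
        then have "y \<in> Field r" by (auto simp: under_def Field_def)
        then have "(y, b) \<in> r \<or> (b, y) \<in> r \<and> y \<noteq> b"
          using wo_total[OF wo bF] wo_refl[OF wo] by blast
        then show "y \<in> under r b \<union> V"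
          using y 2(2) by (auto simp: under_def aboveS_def)
      qed
      then have "under r a \<subseteq> \<Union>(insert V \<F>)" using \<F> by auto
      then show ?thesis using \<F> V by (intro exI[of _ "insert V \<F>"]) auto
    qed
  qed
qed

lemma wo_finite_bound:
  assumes wo: "Well_order r" and "finite F" "F \<subseteq> Field r" "Field r \<noteq> {}"
  shows "\<exists>m\<in>Field r. \<forall>x\<in>F. (x, m) \<in> r"
  using assms(2,3)
proof (induction F rule: finite_induct)
  case empty
  then show ?case using assms(4) by blast
next
  case (insert x F)
  then obtain m where m: "m \<in> Field r" "\<forall>x\<in>F. (x, m) \<in> r" by auto
  have x: "x \<in> Field r" using insert by simp
  consider "(x, m) \<in> r" | "(m, x) \<in> r" using wo_total[OF wo x m(1)] by blast
  then show ?case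
  proof cases
    case 1
    then show ?thesis using m by blast
  next
    case 2
    then have "\<forall>z\<in>insert x F. (z, x) \<in> r" using m wo_trans[OF wo] wo_refl[OF wo x] by blast
    then show ?thesis using x by blast
  qed
qed

lemma compactin_imp_bounded:
  assumes wo: "Well_order r" and "Field r \<noteq> {}" and nomax: "\<And>a. a \<in> Field r \<Longrightarrow> aboveS r a \<noteq> {}"
    and C: "compactin (order_top r) C"
  shows "\<exists>a\<in>Field r. C \<subseteq> under r a"
proof -
  have CF: "C \<subseteq> Field r" using C compactin_subset_topspace by fastforce
  have "C \<subseteq> \<Union>(underS r ` Field r)"
  proof
    fix x assume "x \<in> C"
    then have "x \<in> Field r" using CF by blast
    then obtain y where "y \<in> aboveS r x" using nomax by blast
    then show "x \<in> \<Union>(underS r ` Field r)"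
      by (auto simp: aboveS_def underS_def Field_def)
  qed
  moreover have "Ball (underS r ` Field r) (openin (order_top r))"
    by (auto simp: order_top_def intro!: topology_generated_by_Basis)
  ultimately obtain \<F> where \<F>: "finite \<F>" "\<F> \<subseteq> underS r ` Field r" "C \<subseteq> \<Union>\<F>"
    using C unfolding compactin_def by meson
  then obtain F where F: "F \<subseteq> Field r" "finite F" "\<F> = underS r ` F"
    by (meson finite_subset_image)
  then obtain m where m: "m \<in> Field r" "\<forall>x\<in>F. (x, m) \<in> r"
    using wo_finite_bound[OF wo _ _ assms(2)] by blast
  have "C \<subseteq> under r m"
  proof
    fix x assume "x \<in> C"
    then obtain y where "y \<in> F" "x \<in> underS r y" using \<F>(3) F(3) by blast
    then have "(x, y) \<in> r" "(y, m) \<in> r" using m by (auto simp: underS_def)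
    then show "x \<in> under r m" using wo_trans[OF wo] by (auto simp: under_def)
  qed
  then show ?thesis using m by blast
qed

lemma noncompact_wo_space_iff:
  "noncompact_wo_space r \<longleftrightarrow>
     Well_order r \<and> Field r \<noteq> {} \<and> (\<forall>a\<in>Field r. aboveS r a \<noteq> {})"
proof (cases "Well_order r")
  case wo: True
  show ?thesis
  proof
    assume L: "noncompact_wo_space r"
    then have nc: "\<not> compactin (order_top r) (Field r)"
      by (simp add: noncompact_wo_space_def compact_space_def)
    have "aboveS r a \<noteq> {}" if a: "a \<in> Field r" for a
    proof
      assume e: "aboveS r a = {}"
      have "under r a = Field r"
        using e by (rule under_eq_Field_if[OF wo a])
      then show False using compactin_under[OF wo a] nc by simp
    qed
    moreover have "Field r \<noteq> {}" using nc by auto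
    ultimately show "Well_order r \<and> Field r \<noteq> {} \<and> (\<forall>a\<in>Field r. aboveS r a \<noteq> {})"
      using wo by blast
  next
    assume R: "Well_order r \<and> Field r \<noteq> {} \<and> (\<forall>a\<in>Field r. aboveS r a \<noteq> {})"
    then have ne: "Field r \<noteq> {}" and nomax: "\<And>a. a \<in> Field r \<Longrightarrow> aboveS r a \<noteq> {}" by auto
    have False if co: "compactin (order_top r) (Field r)"
    proof -
      obtain a where a: "a \<in> Field r" "Field r \<subseteq> under r a"
        using compactin_imp_bounded[OF wo ne nomax co] by blast
      then obtain b where b: "(a, b) \<in> r" "b \<noteq> a" using nomax[OF a(1)] by (auto simp: aboveS_def)
      then have "b \<in> Field r" by (auto simp: Field_def)
      then have "(b, a) \<in> r" using a(2) by (auto simp: under_def)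
      then show False using b wo_antisym[OF wo b(1)] by simp
    qed
    then show "noncompact_wo_space r"
      using wo by (auto simp: noncompact_wo_space_def compact_space_def)
  qed
qed (simp add: noncompact_wo_space_def)

lemma openin_wo_compactification:
  assumes "noncompact_wo_space r"
  shows "openin (wo_compactification r) V \<longleftrightarrow>
     V \<subseteq> insert None (Some ` Field r) \<and>
     openin (order_top r) {x. Some x \<in> V} \<and>
     (None \<in> V \<longrightarrow> (\<exists>a\<in>Field r. Some ` aboveS r a \<subseteq> V))"
proof -
  have wo: "Well_order r" and ne: "Field r \<noteq> {}"
    and nomax: "\<And>a. a \<in> Field r \<Longrightarrow> aboveS r a \<noteq> {}"
    using assms by (auto simp: noncompact_wo_space_iff)
  show ?thesis
  proof
    assume V: "openin (wo_compactification r) V"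
    have 1: "V \<subseteq> insert None (Some ` Field r)" using openin_subset[OF V] by simp
    have "{x. Some x \<in> V} = {x \<in> topspace (order_top r). Some x \<in> V}" using 1 by auto
    then have 2: "openin (order_top r) {x. Some x \<in> V}"
      using openin_continuous_map_preimage[OF continuous_map_Some V] by simp
    have 3: "\<exists>a\<in>Field r. Some ` aboveS r a \<subseteq> V" if "None \<in> V"
    proof -
      have "\<nexists>U. V = Some ` U" using that by auto
      then obtain C where C: "compactin (order_top r) C" "V = insert None (Some ` (Field r - C))"
        using V unfolding openin_Alexandroff_compactification topspace_order_top by metis
      obtain a where a: "a \<in> Field r" "C \<subseteq> under r a"
        using compactin_imp_bounded[OF wo ne nomax C(1)] by blast
      have "aboveS r a \<subseteq> Field r - C"
      proof
        fix y assume "y \<in> aboveS r a"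
        then have y: "(a, y) \<in> r" "y \<noteq> a" by (auto simp: aboveS_def)
        then have "y \<notin> under r a" using wo_antisym[OF wo y(1)] by (auto simp: under_def)
        moreover have "y \<in> Field r" using y by (auto simp: Field_def)
        ultimately show "y \<in> Field r - C" using a by blast
      qed
      then show ?thesis using a C by blast
    qed
    show "V \<subseteq> insert None (Some ` Field r) \<and> openin (order_top r) {x. Some x \<in> V} \<and>
      (None \<in> V \<longrightarrow> (\<exists>a\<in>Field r. Some ` aboveS r a \<subseteq> V))"
      using 1 2 3 by blast
  next
    assume R: "V \<subseteq> insert None (Some ` Field r) \<and> openin (order_top r) {x. Some x \<in> V} \<and>
      (None \<in> V \<longrightarrow> (\<exists>a\<in>Field r. Some ` aboveS r a \<subseteq> V))"
    let ?U = "{x. Some x \<in> V}"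
    show "openin (wo_compactification r) V"
    proof (cases "None \<in> V")
      case False
      then have "V = Some ` ?U" using R by auto
      then show ?thesis using R by (metis openin_Alexandroff_compactification)
    next
      case True
      then obtain a where a: "a \<in> Field r" "Some ` aboveS r a \<subseteq> V" using R by blast
      let ?C = "Field r - ?U"
      have cl: "closedin (order_top r) ?C" using R by (metis closedin_diff closedin_topspace topspace_order_top)
      have "?C \<subseteq> under r a"
      proof
        fix x assume x: "x \<in> ?C"
        then have "x \<notin> aboveS r a" using a by blast
        then show "x \<in> under r a"
          using x a wo_total[OF wo a(1), of x] wo_refl[OF wo] by (auto simp: under_def aboveS_def)
      qed
      then have "compactin (order_top r) ?C"
        by (rule closed_compactin[OF compactin_under[OF wo a(1)] _ cl])
      moreover have "V = insert None (Some ` (topspace (order_top r) - ?C))"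
        using R True by auto
      ultimately show ?thesis using cl by (auto simp: openin_Alexandroff_compactification)
    qed
  qed
qed

lemma continuous_map_wo_compactification:
  assumes nc: "noncompact_wo_space r"
  shows "continuous_map (wo_compactification r) X f \<longleftrightarrow>
     f None \<in> topspace X \<and> (\<forall>x\<in>Field r. f (Some x) \<in> topspace X) \<and>
     (\<forall>V. openin X V \<longrightarrow>
        (\<forall>x\<in>Field r. f (Some x) \<in> V \<longrightarrow> wo_nbhd r x {y. f (Some y) \<in> V}) \<and>
        (f None \<in> V \<longrightarrow> (\<exists>a\<in>Field r. \<forall>y\<in>aboveS r a. f (Some y) \<in> V)))"
    (is "_ \<longleftrightarrow> ?R")
proof -
  have wo: "Well_order r" using nc by (simp add: noncompact_wo_space_def)
  have nb: "wo_nbhd r x (Field r \<inter> S) \<longleftrightarrow> wo_nbhd r x S" if "x \<in> Field r" for x S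
    using that by (auto simp: wo_nbhd_def aboveS_def Field_def)
  have sF: "aboveS r a \<subseteq> Field r" for a by (auto simp: aboveS_def Field_def)
  have eq: "{x. Some x \<in> {x \<in> topspace (wo_compactification r). f x \<in> V}} =
      Field r \<inter> {y. f (Some y) \<in> V}" for V by auto
  have key: "openin (wo_compactification r) {x \<in> topspace (wo_compactification r). f x \<in> V} \<longleftrightarrow>
      (\<forall>x\<in>Field r. f (Some x) \<in> V \<longrightarrow> wo_nbhd r x {y. f (Some y) \<in> V}) \<and>
      (f None \<in> V \<longrightarrow> (\<exists>a\<in>Field r. \<forall>y\<in>aboveS r a. f (Some y) \<in> V))" for V
  proof -
    have "Some ` aboveS r a \<subseteq> {x \<in> topspace (wo_compactification r). f x \<in> V} \<longleftrightarrow>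
        (\<forall>y\<in>aboveS r a. f (Some y) \<in> V)" for a
      using sF[of a] by auto
    then show ?thesis
      unfolding openin_wo_compactification[OF nc] eq openin_order_top_iff[OF wo]
      by (auto simp: nb)
  qed
  show ?thesis unfolding continuous_map_def key by (auto simp: Pi_iff)
qed


subsection \<open>Independence of the type carrying the well-ordered spaces\<close>

lemma wo_transfer:
  fixes r :: "'w rel" and j :: "'w \<Rightarrow> 'v"
  assumes nc: "noncompact_wo_space r" and C: "C \<subseteq> Field r"
    and cof: "\<And>a. a \<in> Field r \<Longrightarrow> \<exists>c\<in>C. (a, c) \<in> r"
    and clo: "\<And>e. e \<in> Field r \<Longrightarrow> (\<And>a. a \<in> underS r e \<Longrightarrow> \<exists>c\<in>C. c \<in> aboveS r a \<and> (c, e) \<in> r) \<Longrightarrow> e \<in> C"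
    and j: "inj_on j C"
  obtains r' :: "'v rel" and k where "noncompact_wo_space r'" "k ` Field r' \<subseteq> Field r"
    "\<And>X (f :: 'w option \<Rightarrow> 'a). continuous_map (wo_compactification r) X f \<Longrightarrow>
        continuous_map (wo_compactification r') X (f \<circ> map_option k)"
proof -
  have wo: "Well_order r" and ne: "Field r \<noteq> {}"
    and nomax: "\<And>a. a \<in> Field r \<Longrightarrow> aboveS r a \<noteq> {}"
    using nc by (auto simp: noncompact_wo_space_iff)
  define q where "q = Restr r C"
  have FqC: "Field q = C"
  proof
    show "Field q \<subseteq> C" by (auto simp: q_def Field_def)
    show "C \<subseteq> Field q"
    proof
      fix c assume "c \<in> C"
      then have "(c, c) \<in> q" using wo_refl[OF wo] C by (auto simp: q_def)
      then show "c \<in> Field q" by (auto simp: Field_def)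
    qed
  qed
  have woq: "Well_order q" unfolding q_def by (rule Well_order_Restr[OF wo])
  define r' where "r' = dir_image q j"
  have Fr: "Field r' = j ` C" unfolding r'_def dir_image_Field FqC ..
  have wor': "Well_order r'" unfolding r'_def
    by (rule Well_order_dir_image[OF woq]) (simp add: FqC j)
  have r'I: "(j a, j b) \<in> r' \<longleftrightarrow> (a, b) \<in> r" if "a \<in> C" "b \<in> C" for a b
    using that j by (auto simp: r'_def dir_image_def q_def inj_on_def)
  define k where "k = inv_into C j"
  have kj: "k (j c) = c" if "c \<in> C" for c using that j by (simp add: k_def)
  have img: "S = j ` (T \<inter> C)" if "S \<subseteq> j ` C" "\<And>c. c \<in> C \<Longrightarrow> j c \<in> S \<longleftrightarrow> c \<in> T" for S T
    using that by blast
  have jeq: "j a = j b \<longleftrightarrow> a = b" if "a \<in> C" "b \<in> C" for a b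
    using that j by (auto simp: inj_on_def)
  have aS: "aboveS r' (j a) = j ` (aboveS r a \<inter> C)" if a: "a \<in> C" for a
  proof -
    have "aboveS r' (j a) \<subseteq> j ` C" using Fr by (auto simp: aboveS_def Field_def)
    then show ?thesis by (rule img) (simp add: aboveS_def a r'I jeq)
  qed
  have uS: "underS r' (j a) = j ` (underS r a \<inter> C)" if a: "a \<in> C" for a
  proof -
    have "underS r' (j a) \<subseteq> j ` C" using Fr by (auto simp: underS_def Field_def)
    then show ?thesis by (rule img) (simp add: underS_def a r'I jeq)
  qed
  have u: "under r' (j a) = j ` (under r a \<inter> C)" if a: "a \<in> C" for a
  proof -
    have "under r' (j a) \<subseteq> j ` C" using Fr by (auto simp: under_def Field_def)
    then show ?thesis by (rule img) (simp add: under_def a r'I jeq)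
  qed
  have above_ne: "aboveS r a \<inter> C \<noteq> {}" if aF: "a \<in> Field r" for a
  proof -
    obtain b where b: "b \<in> aboveS r a" using nomax[OF aF] by blast
    then have "b \<in> Field r" by (auto simp: aboveS_def Field_def)
    then obtain c where "c \<in> C" "(b, c) \<in> r" using cof by blast
    then have "c \<in> aboveS r a"
      using b wo_trans[OF wo, of a b c] wo_antisym[OF wo, of a b] by (auto simp: aboveS_def)
    then show ?thesis using \<open>c \<in> C\<close> by blast
  qed
  have nc': "noncompact_wo_space r'"
    unfolding noncompact_wo_space_iff
  proof (intro conjI ballI wor')
    show "Field r' \<noteq> {}" using Fr ne cof by blast
    fix x assume "x \<in> Field r'"
    then obtain a where "a \<in> C" "x = j a" using Fr by blast
    then show "aboveS r' x \<noteq> {}" using aS above_ne C by auto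
  qed
  have kF: "k ` Field r' \<subseteq> Field r" using Fr kj C by auto
  have nbC: "wo_nbhd r' (j c) {y. k y \<in> S}" if c: "c \<in> C" and n: "wo_nbhd r c S" for c S
  proof -
    have cF: "c \<in> Field r" using c C by blast
    consider "underS r c = {}" "c \<in> S" | a where "a \<in> underS r c" "aboveS r a \<inter> under r c \<subseteq> S"
      using n by (auto simp: wo_nbhd_def)
    then show ?thesis
    proof cases
      case 1
      then show ?thesis using uS[OF c] kj[OF c] by (auto simp: wo_nbhd_def)
    next
      case 2
      have aF: "a \<in> Field r" using 2 by (auto simp: underS_def Field_def)
      let ?B = "{e \<in> Field r. \<forall>c\<in>C. (c, a) \<in> r \<longrightarrow> (c, e) \<in> r}"
      have "a \<in> ?B" using aF by blast
      then obtain e where e: "e \<in> ?B" and el: "\<And>s. s \<in> ?B \<Longrightarrow> (e, s) \<in> r"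
        using wo_least[OF wo, of ?B] by blast
      have ea: "(e, a) \<in> r" using el \<open>a \<in> ?B\<close> by blast
      have eC: "e \<in> C"
      proof (rule clo)
        show "e \<in> Field r" using e by blast
        fix b assume b: "b \<in> underS r e"
        then have bF: "b \<in> Field r" by (auto simp: underS_def Field_def)
        have "b \<notin> ?B" using el b wo_antisym[OF wo, of b e] by (auto simp: underS_def)
        then obtain d where d: "d \<in> C" "(d, a) \<in> r" "(d, b) \<notin> r" using bF by blast
        then have "d \<in> Field r" using C by blast
        then have "d \<in> aboveS r b" using d wo_total[OF wo bF] wo_refl[OF wo bF]
          by (auto simp: aboveS_def)
        then show "\<exists>c\<in>C. c \<in> aboveS r b \<and> (c, e) \<in> r" using d e by blast
      qed
      have "e \<in> underS r c"
        using ea 2(1) wo_trans[OF wo, of e a c] wo_antisym[OF wo, of a c]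
        by (auto simp: underS_def)
      moreover have "aboveS r e \<inter> under r c \<inter> C \<subseteq> S"
      proof
        fix y assume y: "y \<in> aboveS r e \<inter> under r c \<inter> C"
        then have yF: "y \<in> Field r" using C by blast
        have "(y, a) \<notin> r" using y e wo_antisym[OF wo, of e y] by (auto simp: aboveS_def)
        then have "y \<in> aboveS r a" using wo_total[OF wo aF yF] wo_refl[OF wo aF]
          by (auto simp: aboveS_def)
        then show "y \<in> S" using y 2 by blast
      qed
      moreover have "aboveS r' (j e) \<inter> under r' (j c) = j ` (aboveS r e \<inter> under r c \<inter> C)"
        unfolding aS[OF eC] u[OF c] using inj_on_image_Int[OF j, of "aboveS r e \<inter> C" "under r c \<inter> C"]
        by (simp add: Int_ac)
      ultimately have "j e \<in> underS r' (j c)" "aboveS r' (j e) \<inter> under r' (j c) \<subseteq> {y. k y \<in> S}"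
        using eC kj by (auto simp: uS[OF c])
      then show ?thesis unfolding wo_nbhd_def by blast
    qed
  qed
  show ?thesis
  proof (rule that[OF nc' kF])
    fix X and f :: "'w option \<Rightarrow> 'a" assume f: "continuous_map (wo_compactification r) X f"
    note f' = f[unfolded continuous_map_wo_compactification[OF nc]]
    show "continuous_map (wo_compactification r') X (f \<circ> map_option k)"
      unfolding continuous_map_wo_compactification[OF nc']
    proof (intro conjI allI impI ballI)
      show "(f \<circ> map_option k) None \<in> topspace X" using f' by simp
      show "(f \<circ> map_option k) (Some x) \<in> topspace X" if "x \<in> Field r'" for x
        using that f' kF by auto
    next
      fix V x assume V: "openin X V" and x: "x \<in> Field r'" "(f \<circ> map_option k) (Some x) \<in> V"
      then obtain c where c: "c \<in> C" "x = j c" using Fr by blast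
      have "c \<in> Field r" "f (Some c) \<in> V" using c C x kj by auto
      then have "wo_nbhd r c {y. f (Some y) \<in> V}" using f' V by blast
      from nbC[OF c(1) this] show "wo_nbhd r' x {y. (f \<circ> map_option k) (Some y) \<in> V}"
        using c by simp
    next
      fix V assume V: "openin X V" "(f \<circ> map_option k) None \<in> V"
      then obtain a where a: "a \<in> Field r" "\<forall>y\<in>aboveS r a. f (Some y) \<in> V" using f' by auto
      obtain c where c: "c \<in> C" "(a, c) \<in> r" using cof a by blast
      have "aboveS r c \<subseteq> aboveS r a"
        using c wo_trans[OF wo] wo_antisym[OF wo] by (auto simp: aboveS_def)
      then have "\<forall>y\<in>aboveS r' (j c). (f \<circ> map_option k) (Some y) \<in> V"
        using aS[OF c(1)] a kj by auto
      then show "\<exists>a\<in>Field r'. \<forall>y\<in>aboveS r' a. (f \<circ> map_option k) (Some y) \<in> V"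
        using Fr c by blast
    qed
  qed
qed

lemma noncompact_wo_space_natLeq: "noncompact_wo_space natLeq"
proof -
  have "Suc a \<in> aboveS natLeq a" for a by (simp add: aboveS_def natLeq_def)
  then have "aboveS natLeq a \<noteq> {}" for a by blast
  then show ?thesis
    using natLeq_Well_order by (simp add: noncompact_wo_space_iff Field_natLeq)
qed

lemma wo_reduction:
  fixes r :: "'w rel" and s :: "'w \<Rightarrow> 'a"
  assumes nc: "noncompact_wo_space r"
  shows "\<exists>(r' :: ('a set + nat) rel) s'. noncompact_wo_space r' \<and> s' ` Field r' \<subseteq> s ` Field r \<and>
    (\<forall>X f. continuous_map (wo_compactification r) X f \<longrightarrow> (\<forall>a\<in>Field r. f (Some a) = s a) \<longrightarrow>
       (\<exists>f'. continuous_map (wo_compactification r') X f' \<and> f' None = f None \<and>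
            (\<forall>a\<in>Field r'. f' (Some a) = s' a)))"
proof -
  have wo: "Well_order r" and ne: "Field r \<noteq> {}"
    and nomax: "\<And>a. a \<in> Field r \<Longrightarrow> aboveS r a \<noteq> {}"
    using nc by (auto simp: noncompact_wo_space_iff)
  show ?thesis
  proof (cases "\<exists>x\<in>s ` Field r. \<forall>b\<in>Field r. \<exists>a\<in>Field r. s a = x \<and> (a, b) \<notin> r")
    case True
    then obtain x where x: "x \<in> s ` Field r"
      and cofin: "\<And>b. b \<in> Field r \<Longrightarrow> \<exists>a\<in>Field r. s a = x \<and> (a, b) \<notin> r" by blast
    obtain r' :: "('a set + nat) rel" and k where r': "noncompact_wo_space r'"
      "k ` Field r' \<subseteq> Field natLeq"
      "\<And>X (f :: nat option \<Rightarrow> 'a). continuous_map (wo_compactification natLeq) X f \<Longrightarrow>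
        continuous_map (wo_compactification r') X (f \<circ> map_option k)"
    proof (rule wo_transfer[OF noncompact_wo_space_natLeq, of UNIV "Inr :: nat \<Rightarrow> 'a set + nat"])
      show "\<exists>c\<in>UNIV. (a, c) \<in> natLeq" for a by (auto simp: natLeq_def)
    qed (auto simp: Field_natLeq intro: that)
    show ?thesis
    proof (rule exI[of _ r'], rule exI[of _ "\<lambda>_. x"], intro conjI allI impI r'(1))
      show "(\<lambda>_. x) ` Field r' \<subseteq> s ` Field r" using x by auto
      fix X f assume f: "continuous_map (wo_compactification r) X f"
        and fs: "\<forall>a\<in>Field r. f (Some a) = s a"
      note f' = f[unfolded continuous_map_wo_compactification[OF nc]]
      have lim: "x \<in> V" if V: "openin X V" "f None \<in> V" for V
      proof -
        obtain b where b: "b \<in> Field r" "\<forall>y\<in>aboveS r b. f (Some y) \<in> V" using f' V by blast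
        obtain a where a: "a \<in> Field r" "s a = x" "(a, b) \<notin> r" using cofin b by blast
        then have "a \<in> aboveS r b" using wo_total[OF wo a(1) b(1)] wo_refl[OF wo b(1)]
          by (auto simp: aboveS_def)
        then show ?thesis using a b fs by auto
      qed
      have xX: "x \<in> topspace X" using x f' fs by force
      let ?g = "case_option (f None) (\<lambda>_. x)"
      have "continuous_map (wo_compactification r') X ?g"
        unfolding continuous_map_wo_compactification[OF r'(1)]
      proof (intro conjI allI impI ballI)
        fix V c assume "c \<in> Field r'" "?g (Some c) \<in> V"
        then show "wo_nbhd r' c {y. ?g (Some y) \<in> V}" by (auto simp: wo_nbhd_def)
      next
        fix V assume "openin X V" "?g None \<in> V"
        then have "x \<in> V" using lim by simp
        then show "\<exists>a\<in>Field r'. \<forall>y\<in>aboveS r' a. ?g (Some y) \<in> V"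
          using r'(1) by (auto simp: noncompact_wo_space_iff)
      qed (use xX f' in auto)
      then show "\<exists>f'. continuous_map (wo_compactification r') X f' \<and> f' None = f None \<and>
            (\<forall>a\<in>Field r'. f' (Some a) = x)"
        by (intro exI[of _ ?g]) simp
    qed
  next
    case False
    then have "\<forall>x\<in>s ` Field r. \<exists>b. b \<in> Field r \<and> (\<forall>a\<in>Field r. s a = x \<longrightarrow> (a, b) \<in> r)" by blast
    then obtain b where b: "\<And>x. x \<in> s ` Field r \<Longrightarrow> b x \<in> Field r"
      "\<And>a. a \<in> Field r \<Longrightarrow> (a, b (s a)) \<in> r"
      by (metis image_eqI)
    define D where "D = b ` s ` Field r"
    define C where "C = {c \<in> Field r. \<forall>a\<in>underS r c. \<exists>d\<in>D. d \<in> aboveS r a \<and> (d, c) \<in> r}"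
    have DF: "D \<subseteq> Field r" using b by (auto simp: D_def)
    have DC: "D \<subseteq> C"
    proof
      fix d assume d: "d \<in> D"
      then have "d \<in> Field r" using DF by blast
      moreover have "d \<in> aboveS r a \<and> (d, d) \<in> r" if "a \<in> underS r d" for a
        using that wo_refl[OF wo \<open>d \<in> Field r\<close>] by (auto simp: aboveS_def underS_def)
      ultimately show "d \<in> C" using d unfolding C_def by blast
    qed
    define j :: "'w \<Rightarrow> 'a set + nat"
      where "j = (\<lambda>c. Inl {x \<in> s ` Field r. (b x, c) \<in> r})"
    have neq: "j c \<noteq> j c'" if c: "c \<in> C" "c' \<in> C" "c' \<in> underS r c" for c c'
    proof -
      obtain d where d: "d \<in> D" "d \<in> aboveS r c'" "(d, c) \<in> r" using c by (auto simp: C_def)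
      then obtain x where x: "x \<in> s ` Field r" "d = b x" by (auto simp: D_def)
      have "(d, c') \<notin> r" using d wo_antisym[OF wo, of d c'] by (auto simp: aboveS_def)
      then show ?thesis using x d by (auto simp: j_def set_eq_iff)
    qed
    have CF: "C \<subseteq> Field r" by (auto simp: C_def)
    have j: "inj_on j C"
    proof (rule inj_onI, rule ccontr)
      fix c c' assume c: "c \<in> C" "c' \<in> C" "j c = j c'" "c \<noteq> c'"
      then have "c' \<in> underS r c \<or> c \<in> underS r c'"
        using wo_total[OF wo, of c c'] CF by (auto simp: underS_def)
      then show False using neq c by metis
    qed
    have c1: "\<exists>c\<in>C. (a, c) \<in> r" if "a \<in> Field r" for a
      using b(2)[OF that] DC that by (auto simp: D_def)
    have c3: "e \<in> C" if e: "e \<in> Field r"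
      and H: "\<And>a. a \<in> underS r e \<Longrightarrow> \<exists>c\<in>C. c \<in> aboveS r a \<and> (c, e) \<in> r" for e
      unfolding C_def
    proof (intro CollectI conjI e ballI)
      fix a assume "a \<in> underS r e"
      then obtain c where c: "c \<in> C" "c \<in> aboveS r a" "(c, e) \<in> r" using H by blast
      then have "a \<in> underS r c" by (auto simp: aboveS_def underS_def)
      then obtain d where "d \<in> D" "d \<in> aboveS r a" "(d, c) \<in> r" using c by (auto simp: C_def)
      then show "\<exists>d\<in>D. d \<in> aboveS r a \<and> (d, e) \<in> r" using c wo_trans[OF wo] by blast
    qed
    obtain r' :: "('a set + nat) rel" and k where r': "noncompact_wo_space r'"
      "k ` Field r' \<subseteq> Field r"
      "\<And>X (f :: 'w option \<Rightarrow> 'a). continuous_map (wo_compactification r) X f \<Longrightarrow>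
        continuous_map (wo_compactification r') X (f \<circ> map_option k)"
      by (rule wo_transfer[OF nc CF c1 c3 j]) (auto intro: that)
    show ?thesis
    proof (rule exI[of _ r'], rule exI[of _ "s \<circ> k"], intro conjI allI impI r'(1))
      show "(s \<circ> k) ` Field r' \<subseteq> s ` Field r" using r'(2) by auto
      fix X f assume "continuous_map (wo_compactification r) X f"
        and "\<forall>a\<in>Field r. f (Some a) = s a"
      then show "\<exists>f'. continuous_map (wo_compactification r') X f' \<and> f' None = f None \<and>
            (\<forall>a\<in>Field r'. f' (Some a) = (s \<circ> k) a)"
        using r'(2) r'(3)[of X f] by (intro exI[of _ "f \<circ> map_option k"]) auto
    qed
  qed
qed

lemma strongly_pseudoradial_witness_transfer:
  fixes r :: "'w rel" and f :: "'w option \<Rightarrow> 'a"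
  assumes r: "noncompact_wo_space r" "continuous_map (wo_compactification r) X f"
    "f ` Some ` Field r \<subseteq> A" "f None \<notin> A"
  shows "\<exists>(r' :: ('a set + nat) rel) f'. noncompact_wo_space r' \<and>
    continuous_map (wo_compactification r') X f' \<and> f' ` Some ` Field r' \<subseteq> A \<and> f' None \<notin> A"
proof -
  obtain r' :: "('a set + nat) rel" and s'
    where r': "noncompact_wo_space r'" "s' ` Field r' \<subseteq> (f \<circ> Some) ` Field r"
      "\<forall>X g. continuous_map (wo_compactification r) X g \<longrightarrow>
       (\<forall>a\<in>Field r. g (Some a) = (f \<circ> Some) a) \<longrightarrow>
       (\<exists>f'. continuous_map (wo_compactification r') X f' \<and> f' None = g None \<and>
            (\<forall>a\<in>Field r'. f' (Some a) = s' a))"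
    using wo_reduction[OF r(1), of "f \<circ> Some"] by (elim exE conjE)
  obtain f' where f': "continuous_map (wo_compactification r') X f'" "f' None = f None"
    "\<forall>a\<in>Field r'. f' (Some a) = s' a"
    using r'(3)[THEN spec[of _ X], THEN spec[of _ f], THEN mp, OF r(2)] by auto
  have "f' ` Some ` Field r' \<subseteq> A" using f'(3) r'(2) r(3) by fastforce
  moreover have "f' None \<notin> A" using f'(2) r(4) by simp
  ultimately show ?thesis using r'(1) f'(1) by (intro exI[of _ r'] exI[of _ f'] conjI)
qed

lemma strongly_pseudoradial_if:
  fixes X :: "'a topology"
  assumes "strongly_pseudoradial_on TYPE('w) X"
  shows "strongly_pseudoradial X"
  unfolding strongly_pseudoradial_def strongly_pseudoradial_on_def
proof (intro allI impI)
  fix A assume A: "A \<subseteq> topspace X \<and> \<not> closedin X A"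
  obtain r :: "'w rel" and f where r: "noncompact_wo_space r"
    "continuous_map (wo_compactification r) X f" "f ` Some ` Field r \<subseteq> A" "f None \<notin> A"
    using assms[unfolded strongly_pseudoradial_on_def, THEN spec[of _ A], THEN mp, OF A] by (elim exE conjE)
  then show "\<exists>(r :: ('a set + nat) rel) f. noncompact_wo_space r \<and>
      continuous_map (wo_compactification r) X f \<and> f ` Some ` Field r \<subseteq> A \<and> f None \<notin> A"
    by (rule strongly_pseudoradial_witness_transfer)
qed

lemma unique_limit_transfer:
  fixes X :: "'a topology" and r :: "'w rel"
  assumes U: "unique_strong_pseudoradial_convergence X"
    and r: "noncompact_wo_space r"
    and f: "continuous_map (wo_compactification r) X f"
    and g: "continuous_map (wo_compactification r) X g"
    and fg: "\<forall>a\<in>Field r. f (Some a) = g (Some a)"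
  shows "f None = g None"
proof -
  obtain r' :: "('a set + nat) rel" and s'
    where r': "noncompact_wo_space r'"
      "\<forall>X h. continuous_map (wo_compactification r) X h \<longrightarrow>
       (\<forall>a\<in>Field r. h (Some a) = (f \<circ> Some) a) \<longrightarrow>
       (\<exists>f'. continuous_map (wo_compactification r') X f' \<and> f' None = h None \<and>
            (\<forall>a\<in>Field r'. f' (Some a) = s' a))"
    using wo_reduction[OF r, of "f \<circ> Some"] by (elim exE conjE)
  obtain f' where f': "continuous_map (wo_compactification r') X f'" "f' None = f None"
    "\<forall>a\<in>Field r'. f' (Some a) = s' a"
    using r'(2)[THEN spec[of _ X], THEN spec[of _ f], THEN mp, OF f] by auto
  obtain g' where g': "continuous_map (wo_compactification r') X g'" "g' None = g None"
    "\<forall>a\<in>Field r'. g' (Some a) = s' a"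
    using r'(2)[THEN spec[of _ X], THEN spec[of _ g], THEN mp, OF g] fg by auto
  have H: "noncompact_wo_space r' \<and> continuous_map (wo_compactification r') X f' \<and>
      continuous_map (wo_compactification r') X g' \<and> (\<forall>a\<in>Field r'. f' (Some a) = g' (Some a))"
    using r'(1) f' g' by simp
  note * = U[unfolded unique_strong_pseudoradial_convergence_def
      unique_strong_pseudoradial_convergence_on_def]
  have "f' None = g' None"
    by (rule *[THEN spec[of _ r'], THEN spec[of _ f'], THEN spec[of _ g'], THEN mp, OF H])
  then show "f None = g None" using f' g' by simp
qed

lemma unique_strong_pseudoradial_convergence_imp:
  fixes X :: "'a topology"
  assumes U: "unique_strong_pseudoradial_convergence X"
  shows "unique_strong_pseudoradial_convergence_on TYPE('w) X"
  unfolding unique_strong_pseudoradial_convergence_on_def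
proof (rule allI, rule allI, rule allI)
  fix r :: "'w rel" and f g
  show "noncompact_wo_space r \<and> continuous_map (wo_compactification r) X f \<and>
      continuous_map (wo_compactification r) X g \<and>
      (\<forall>a\<in>Field r. f (Some a) = g (Some a)) \<longrightarrow> f None = g None"
    using unique_limit_transfer[OF U, of r f g] by blast
qed

end

theory Submission
  imports Defs
begin

text \<open>
  The images of the initial segments \<open>[0, a]\<close> are closed by induction on \<open>a\<close>, with the point
  at infinity as the last step. If the image \<open>K\<close> of \<open>[0, a]\<close> is not closed, take a map \<open>f\<close> on
  some \<open>\<beta> \<union> {\<infinity>}\<close> with values in \<open>K\<close> below infinity and a limit outside \<open>K\<close>. By induction, \<open>f\<close>
  eventually leaves the closed image of \<open>[0, b]\<close> for every \<open>b < a\<close>, so \<open>f\<close> also converges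
  to \<open>h a\<close>; uniqueness of limits then puts the limit of \<open>f\<close> in \<open>K\<close>.
\<close>

text \<open>Shared by the induction step and the point at infinity: \<open>p\<close> is the image of
  the last point, and \<open>L\<close> the image of a shorter initial segment.\<close>

lemma closedin_if_closed_away_from_point:
  fixes X :: "'a topology"
  assumes sp: "strongly_pseudoradial X"
    and un: "unique_strong_pseudoradial_convergence X"
    and K: "K \<subseteq> topspace X" and p: "p \<in> K"
    and away: "\<And>V. openin X V \<Longrightarrow> p \<in> V \<Longrightarrow> \<exists>L. closedin X L \<and> L \<subseteq> K \<and> K \<subseteq> V \<union> L"
  shows "closedin X K"
proof (rule ccontr)
  assume "\<not> closedin X K"
  then obtain r :: "('a set + nat) rel" and f where nc: "noncompact_wo_space r"
    and f: "continuous_map (wo_compactification r) X f"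
    and fK: "f ` Some ` Field r \<subseteq> K" and lim: "f None \<notin> K"
    using sp K unfolding strongly_pseudoradial_def strongly_pseudoradial_on_def by blast
  note f' = f[unfolded continuous_map_wo_compactification[OF nc]]
  \<comment> \<open>Moving only the limit of \<open>f\<close> to \<open>p\<close> contradicts
    uniqueness once \<open>g\<close> is continuous; \<open>tail\<close> is its continuity at
    \<open>None\<close>.\<close>
  define g where "g = f(None := p)"
  have tail: "\<exists>a\<in>Field r. \<forall>y\<in>aboveS r a. f (Some y) \<in> V" if V: "openin X V" "p \<in> V" for V
  proof -
    obtain L where L: "closedin X L" "L \<subseteq> K" "K \<subseteq> V \<union> L"
      using away[OF V] by blast
    \<comment> \<open>As \<open>f None\<close> lies outside \<open>K\<close>, the complement of
      \<open>L\<close> is a neighbourhood of it, so a tail of \<open>f\<close> avoids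
      \<open>L\<close> and falls into \<open>V\<close>.\<close>
    have "openin X (topspace X - L)" "f None \<in> topspace X - L"
      using L lim f' by auto
    then obtain a where a: "a \<in> Field r" "\<forall>y\<in>aboveS r a. f (Some y) \<in> topspace X - L"
      using f' by blast
    have "aboveS r a \<subseteq> Field r" by (auto simp: aboveS_def Field_def)
    then have "\<forall>y\<in>aboveS r a. f (Some y) \<in> V"
      using a L fK by blast
    then show ?thesis using a by blast
  qed
  have "continuous_map (wo_compactification r) X g"
    unfolding continuous_map_wo_compactification[OF nc]
    using f' tail p K by (auto simp: g_def)
  then have "f None = g None"
    using unique_limit_transfer[OF un nc f] by (simp add: g_def)
  then show False using lim p by (simp add: g_def)
qed

text \<open>Successors and limits are treated alike: continuity at \<open>a\<close> gives some
  \<open>b\<close> below \<open>a\<close> with the image of \<open>(b, a]\<close> in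
  \<open>V\<close>, and \<open>[0, b]\<close> is covered by induction.\<close>

lemma closedin_image_under:
  assumes sp: "strongly_pseudoradial X"
    and un: "unique_strong_pseudoradial_convergence X"
    and nc: "noncompact_wo_space r"
    and h: "continuous_map (wo_compactification r) X h"
    and a: "a \<in> Field r"
  shows "closedin X (h ` Some ` under r a)"
proof -
  have wo: "Well_order r" using nc by (simp add: noncompact_wo_space_def)
  note h' = h[unfolded continuous_map_wo_compactification[OF nc]]
  show ?thesis
    using a
  proof (rule wo_induct[OF wo])
    fix a assume a: "a \<in> Field r"
      and IH: "\<And>b. b \<in> underS r a \<Longrightarrow> closedin X (h ` Some ` under r b)"
    show "closedin X (h ` Some ` under r a)"
    proof (rule closedin_if_closed_away_from_point[OF sp un, where p = "h (Some a)"])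
      have "under r a \<subseteq> Field r" by (auto simp: under_def Field_def)
      then show "h ` Some ` under r a \<subseteq> topspace X" using h' by auto
      show "h (Some a) \<in> h ` Some ` under r a"
        using wo_refl[OF wo a] by (auto simp: under_def)
    next
      fix V assume V: "openin X V" "h (Some a) \<in> V"
      then have "wo_nbhd r a {y. h (Some y) \<in> V}" using h' a by blast
      then consider "underS r a = {}"
        | b where "b \<in> underS r a" "aboveS r b \<inter> under r a \<subseteq> {y. h (Some y) \<in> V}"
        by (auto simp: wo_nbhd_def)
      then show "\<exists>L. closedin X L \<and> L \<subseteq> h ` Some ` under r a \<and> h ` Some ` under r a \<subseteq> V \<union> L"
      proof cases
        case 1
        \<comment> \<open>Here \<open>a\<close> is the least element, so the image is the single
          point \<open>h (Some a)\<close>.\<close>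
        then have "h ` Some ` under r a \<subseteq> V" using V by (auto simp: under_def underS_def)
        then show ?thesis by (intro exI[of _ "{}"]) auto
      next
        case 2
        have bF: "b \<in> Field r" using 2 by (auto simp: underS_def Field_def)
        have "under r b \<subseteq> under r a"
          using 2 wo_trans[OF wo] by (auto simp: under_def underS_def)
        moreover have "under r a \<subseteq> aboveS r b \<union> under r b"
          using wo_total[OF wo bF] wo_refl[OF wo bF]
          by (fastforce simp: under_def aboveS_def Field_def)
        ultimately show ?thesis
          using 2 IH[OF 2(1)] by (intro exI[of _ "h ` Some ` under r b"]) blast
      qed
    qed
  qed
qed

theorem theorem4p1:
  fixes X :: "'a topology" and r :: "'w rel" and h :: "'w option \<Rightarrow> 'a"
  assumes "strongly_pseudoradial X"
    and "unique_strong_pseudoradial_convergence X"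
    and "noncompact_wo_space r"
    and "continuous_map (wo_compactification r) X h"
    and "inj_on h (topspace (wo_compactification r))"
  shows "closedin X (h ` topspace (wo_compactification r))"
proof (rule closedin_if_closed_away_from_point[OF assms(1,2), where p = "h None"])
  have wo: "Well_order r" using assms(3) by (simp add: noncompact_wo_space_def)
  note h' = assms(4)[unfolded continuous_map_wo_compactification[OF assms(3)]]
  show "h ` topspace (wo_compactification r) \<subseteq> topspace X" using h' by auto
  show "h None \<in> h ` topspace (wo_compactification r)" by simp
  fix V assume V: "openin X V" "h None \<in> V"
  \<comment> \<open>Only the image of \<open>[0, a]\<close> can lie outside \<open>V\<close>; it
    serves as \<open>L\<close>.\<close>
  then obtain a where a: "a \<in> Field r" "\<forall>y\<in>aboveS r a. h (Some y) \<in> V" using h' by blast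
  have "under r a \<subseteq> Field r" by (auto simp: under_def Field_def)
  moreover have "Field r \<subseteq> aboveS r a \<union> under r a"
    using wo_total[OF wo a(1)] wo_refl[OF wo a(1)] by (auto simp: under_def aboveS_def)
  ultimately show "\<exists>L. closedin X L \<and> L \<subseteq> h ` topspace (wo_compactification r) \<and>
      h ` topspace (wo_compactification r) \<subseteq> V \<union> L"
    using a V closedin_image_under[OF assms(1-4) a(1)]
    by (intro exI[of _ "h ` Some ` under r a"]) auto
qed

end
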